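(* At all steps $t\ge 0$ let $g$ be a normalized layer of a differentiable model $f_{\theta_t}:\mathcal X\to\mathcal Y$, where $g$ is parameterized by the matrix $W_t=U_tV_t^T$ with $U_t\in\mathbb R^{m\times r}$, $V_t\in\mathbb R^{n\times r}$, $r\ge 1$, and $W_t\neq 0$. Suppose both $P=U$ and $P=V$ are updated by stochastic gradient descent, $P_{t+1}=P_t-\eta\nabla_{P_t}$, using the gradient $\nabla_{P_t}=\frac1{|\mathcal B|}\sum_{(x,y)\in\mathcal B}\nabla_{P_t}\ell(f_{\theta_t}(x),y)$ over a batch $\mathcal B\subset\mathcal X\times\mathcal Y$, with $\eta>0$ sufficiently small. Let $$\hat\nabla_t=\nabla_{\hat W_t}V_tV_t^T+U_tU_t^T\nabla_{\hat W_t}.$$ Then the vectorized direction $\hat w_t=\operatorname{vec}(\hat W_t)$ of $W_t=U_tV_t^T$ is updated as $$\hat w_{t+1}=\hat w_t-\frac{\eta}{\|W_t\|_F^2}\left(I_{mn}-\hat w_t\hat w_t^T\right)\operatorname{vec}(\hat\nabla_t)+\mathcal O(\eta^2).$$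
   Context: A layer $g(W,x)$ parameterized by $W\in\mathbb R^{m\times n}$ is called normalized if $g(W,x)=g(\rho W,x)$ for all $W\in\mathbb R^{m\times n}$, all inputs $x$, and all scalars $\rho>0$. The model $f_\theta$ is a composition of layers $x_i=g_i(W_i,x_{i-1})$ with $x_0=x$ the input and the last $x_i$ the output; here one layer $g$ has its matrix parameter $W$ written as $W=UV^T$, so the loss depends on $U,V$ only through $W=UV^T$. The function $\ell:\mathcal Y\times\mathcal Y\to\mathbb R$ is a scalar-valued loss, and "differentiable" means that the gradients of the loss with respect to the parameters involved exist. For a nonzero matrix $W_t$, its direction is $\hat W_t=W_t/\|W_t\|_F$, where $\|\cdot\|_F$ is the Frobenius norm. $\operatorname{vec}$ denotes vectorization of an $m\times n$ matrix into a vector in $\mathbb R^{mn}$, and $I_{mn}$ is the identity matrix of size $mn$. The symbol $\nabla_{\hat W_t}\in\mathbb R^{m\times n}$ denotes the gradient of the average batch loss $\frac1{|\mathcal B|}\sum_{(x,y)\in\mathcal B}\ell(f(x),y)$ with respect to the matrix parameter of the layer $g$, evaluated at $\hat W_t$ with all other parameters of $\theta_t$ fixed. The term $\mathcal O(\eta^2)$ is understood as $\eta\to0$ with $U_t$, $V_t$, the remaining parameters at step $t$, and the batch $\mathcal B$ held fixed. *)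

theory Defs
  imports "HOL-Analysis.Analysis" "HOL-Library.Landau_Symbols"
begin

definition normalized_layer :: "(real^'n^'m \<Rightarrow> 'a \<Rightarrow> 'b) \<Rightarrow> bool" where
  "normalized_layer g \<longleftrightarrow> (\<forall>W x. \<forall>\<rho>>0. g W x = g (\<rho> *\<^sub>R W) x)"

text \<open>
  The model is a composition of layers, one of which is \<open>g\<close>.  Here \<open>pre\<close> is the composition of
  the layers before \<open>g\<close>, \<open>post\<close> that of the layers after \<open>g\<close>, and \<open>\<omega>\<close> collects all parameters of
  the model other than the matrix \<open>W\<close> of \<open>g\<close>.
\<close>

definition is_layer_of ::
  "(real^'n^'m \<Rightarrow> 'a \<Rightarrow> 'b) \<Rightarrow> (real^'n^'m \<Rightarrow> 'p \<Rightarrow> 'x \<Rightarrow> 'y) \<Rightarrow> bool" where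
  "is_layer_of g f \<longleftrightarrow>
     (\<exists>(pre :: 'p \<Rightarrow> 'x \<Rightarrow> 'a) (post :: 'p \<Rightarrow> 'b \<Rightarrow> 'y). \<forall>W \<omega> x. f W \<omega> x = post \<omega> (g W (pre \<omega> x)))"

text \<open>
  On matrices, the library's inner product is the Frobenius inner product and \<open>norm\<close> is the
  Frobenius norm (see \<open>norm_matrix_eq_frobenius\<close> below), so the gradient of a function of a matrix
  is the matrix of its partial derivatives.  The value is meaningful only where \<open>F\<close> is
  differentiable.
\<close>

definition gradient :: "('v::real_inner \<Rightarrow> real) \<Rightarrow> 'v \<Rightarrow> 'v" where
  "gradient F x = (THE D. GDERIV F x :> D)"

lemma norm_matrix_eq_frobenius:
  fixes A :: "real^'n^'m"
  shows "norm A = sqrt (\<Sum>i\<in>UNIV. \<Sum>j\<in>UNIV. (A $ i $ j)\<^sup>2)"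
  by (simp add: norm_vec_def L2_set_def sum_nonneg)

definition batch_mean :: "('x \<times> 'y) set \<Rightarrow> ('x \<Rightarrow> 'y \<Rightarrow> 'v::real_vector) \<Rightarrow> 'v" where
  "batch_mean B F = (1 / real (card B)) *\<^sub>R (\<Sum>(x, y)\<in>B. F x y)"

definition direction :: "real^'n^'m \<Rightarrow> real^'n^'m" where
  "direction W = (1 / norm W) *\<^sub>R W"

text \<open>
  The coordinates of \<open>\<real>\<^sup>m\<^sup>n\<close> are indexed by pairs (row, column) instead of by numbers up to \<open>mn\<close>.
\<close>

definition vectorize :: "real^'n^'m \<Rightarrow> real^('m \<times> 'n)" where
  "vectorize A = (\<chi> p. A $ fst p $ snd p)"

definition outer :: "real^'k \<Rightarrow> real^'k \<Rightarrow> real^'k^'k" where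
  "outer v w = (\<chi> i j. v $ i * w $ j)"

end

(* The batch loss L is invariant under positive scaling of W, so its gradient is homogeneous of
   degree -1: the gradient at W_t is 1 / |W_t| times the one at W_t / |W_t|.  By the chain rule
   through W = U V^T, a step on both factors moves W_t by -(eta / |W_t|) G, up to eta^2 times a
   constant matrix.  Normalization W / |W| has derivative H |-> (H - <w, H> w) / |W| at W, where
   w = W / |W|, with a remainder of size O(|H|^2); this supplies the projection and the second
   factor 1 / |W_t|. *)

theory Submission
  imports Defs
begin

section \<open>First-order expansion of normalization\<close>

text \<open>The lower bound is Cauchy-Schwarz for \<open>sgn a\<close> and \<open>a + h\<close>. For
  the upper one, expand the square of \<open>norm (a + h)\<close> and compare it with 2 |a| |a + h|
  \<le> |a|^2 + |a + h|^2; what is left over is |h|^2.\<close>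

lemma norm_remainder_bounds:
  fixes a h :: "'v::real_inner"
  assumes "a \<noteq> 0"
  defines "e \<equiv> norm (a + h) - norm a - inner (sgn a) h"
  shows "0 \<le> e" and "e \<le> (norm h)\<^sup>2 / (2 * norm a)"
proof -
  have q: "norm a > 0" using assms(1) by simp
  have sq: "norm (sgn a) = 1" using assms(1) by (simp add: norm_sgn)
  have sa: "inner (sgn a) a = norm a"
    using q by (simp add: sgn_div_norm dot_square_norm power2_eq_square)
  have "inner (sgn a) (a + h) \<le> norm (a + h)"
    using norm_cauchy_schwarz[of "sgn a" "a + h"] sq by simp
  then show "0 \<le> e" by (simp add: e_def inner_add_right sa)
  have "inner a h = norm a * inner (sgn a) h"
    using q by (simp add: sgn_div_norm)
  then have "(norm (a + h))\<^sup>2 = (norm a)\<^sup>2 + 2 * norm a * inner (sgn a) h + (norm h)\<^sup>2"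
    by (simp add: power2_norm_eq_inner inner_add inner_commute)
  moreover have "2 * norm a * norm (a + h) \<le> (norm a)\<^sup>2 + (norm (a + h))\<^sup>2"
    by (rule sum_squares_bound)
  ultimately have "2 * norm a * e \<le> (norm h)\<^sup>2"
    by (simp add: e_def algebra_simps power2_eq_square)
  then show "e \<le> (norm h)\<^sup>2 / (2 * norm a)"
    using q by (simp add: field_simps)
qed

text \<open>Multiplying the remainder by |a + h| |a| clears the denominators, and every term that
  survives has two factors of order |h|. The bound on \<open>h\<close> keeps |a + h| at least |a| /
  2, so dividing back costs only a constant.\<close>

lemma sgn_first_order_expansion:
  fixes a h :: "'v::real_inner"
  assumes a: "a \<noteq> 0" and h: "norm h \<le> norm a / 2"
  shows "norm (sgn (a + h) - sgn a - (1 / norm a) *\<^sub>R (h - inner (sgn a) h *\<^sub>R sgn a))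
           \<le> 5 * (norm h)\<^sup>2 / (norm a)\<^sup>2"
proof -
  define p q u s e where defs: "p = norm (a + h)" "q = norm a" "u = sgn a" "s = inner u h" "e = p - q - s"
  have q: "q > 0" using a by (simp add: defs)
  have pq: "\<bar>p - q\<bar> \<le> norm h" unfolding defs by (metis add_diff_cancel_left' norm_triangle_ineq3)
  have p2: "p \<ge> q / 2" using pq h defs by linarith
  then have p: "p > 0" using q by linarith
  have u: "norm u = 1" using a by (simp add: defs norm_sgn)
  have au: "a = q *\<^sub>R u" using q by (simp add: defs sgn_div_norm)
  have s: "\<bar>s\<bar> \<le> norm h" unfolding defs(4) using Cauchy_Schwarz_ineq2[of u h] u by simp
  have e: "\<bar>e\<bar> \<le> (norm h)\<^sup>2 / (2 * q)"
    using norm_remainder_bounds[OF a, of h] by (simp add: defs)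
  define R where "R = sgn (a + h) - sgn a - (1 / norm a) *\<^sub>R (h - inner (sgn a) h *\<^sub>R sgn a)"
  have R: "R = (1 / p) *\<^sub>R (a + h) - u - (1 / q) *\<^sub>R (h - s *\<^sub>R u)"
    unfolding R_def by (simp add: defs sgn_div_norm inverse_eq_divide)
  have c: "p = q + s + e" by (simp add: defs)
  have "(p * q) *\<^sub>R R = q *\<^sub>R (a + h) - (p * q) *\<^sub>R u - p *\<^sub>R (h - s *\<^sub>R u)"
    unfolding R using p q by (simp add: algebra_simps)
  \<comment> \<open>Substituting a = q u and p = q + s + e cancels the terms of first order in
    \<open>h\<close>; \<open>e\<close> is itself quadratic by the preceding lemma.\<close>
  also have "\<dots> = ((p - q) * s) *\<^sub>R u - s *\<^sub>R h - e *\<^sub>R (a + h)"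
    unfolding au c by (simp add: algebra_simps)
  finally have "norm ((p * q) *\<^sub>R R) \<le> \<bar>p - q\<bar> * \<bar>s\<bar> + \<bar>s\<bar> * norm h + \<bar>e\<bar> * p"
    using norm_triangle_ineq4[of "((p - q) * s) *\<^sub>R u - s *\<^sub>R h" "e *\<^sub>R (a + h)"]
      norm_triangle_ineq4[of "((p - q) * s) *\<^sub>R u" "s *\<^sub>R h"] u
    by (simp add: abs_mult defs(1))
  also have "\<dots> \<le> norm h * norm h + norm h * norm h + (norm h)\<^sup>2 / (2 * q) * p"
    using pq s e p by (intro add_mono mult_mono) auto
  \<comment> \<open>Since q \<le> 2 p, the first two summands are at most 4 p |h|^2 / q together;
    the third is p |h|^2 / (2 q). The total factor 4.5 is rounded up to 5.\<close>
  also have "\<dots> \<le> (p * q) * (5 * (norm h)\<^sup>2 / q\<^sup>2)"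
  proof -
    have "2 * (norm h)\<^sup>2 * q \<le> 2 * (norm h)\<^sup>2 * (2 * p)"
      using p2 by (intro mult_left_mono) auto
    moreover have "0 \<le> p * (norm h)\<^sup>2" using p by simp
    ultimately show ?thesis
      using q by (simp add: divide_simps power2_eq_square algebra_simps)
  qed
  finally have "(p * q) * norm R \<le> (p * q) * (5 * (norm h)\<^sup>2 / q\<^sup>2)"
    using p q by simp
  then have "norm R \<le> 5 * (norm h)\<^sup>2 / q\<^sup>2"
    by (simp only: mult_le_cancel_left_pos[OF mult_pos_pos[OF p q]])
  then show ?thesis by (simp only: R_def defs(2))
qed

text \<open>A step on two factors of a product perturbs it by a term linear in \<eta> and one
  quadratic in \<eta>. The quadratic one changes the direction only at order \<eta>^2, so
  \<open>b\<close> alone enters the expansion.\<close>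

lemma sgn_quadratic_perturbation:
  fixes a b c :: "'v::real_inner"
  assumes "a \<noteq> 0"
  shows "(\<lambda>\<eta>. norm (sgn (a - \<eta> *\<^sub>R b + \<eta>\<^sup>2 *\<^sub>R c)
            - (sgn a - (\<eta> / norm a) *\<^sub>R (b - inner (sgn a) b *\<^sub>R sgn a)))) \<in> O[at_right 0](\<lambda>\<eta>. \<eta>\<^sup>2)"
proof -
  \<comment> \<open>The perturbation has norm at most \<eta> \<open>K\<close>. In \<open>L\<close>,
    the first summand comes from the expansion of \<open>sgn\<close>, the second from the linear
    image of \<open>c\<close>. \<open>P\<close> is the orthogonal projection onto the complement of
    \<open>a\<close>; the crude bound 2 |v| on it suffices.\<close>
  define K where "K = norm b + norm c"
  define L where "L = 5 * K\<^sup>2 / (norm a)\<^sup>2 + 2 * norm c / norm a"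
  define P where "P v = v - inner (sgn a) v *\<^sub>R sgn a" for v
  have K: "K \<ge> 0" by (simp add: K_def)
  have P_lin: "P (x + y) = P x + P y" "P (r *\<^sub>R x) = r *\<^sub>R P x" for x y r
    by (simp_all add: P_def inner_add_right algebra_simps)
  have P_bound: "norm (P v) \<le> 2 * norm v" for v
  proof -
    have "norm (inner (sgn a) v *\<^sub>R sgn a) \<le> norm v"
      using Cauchy_Schwarz_ineq2[of "sgn a" v] assms by (simp add: norm_sgn)
    then show ?thesis unfolding P_def using norm_triangle_ineq4[of v "inner (sgn a) v *\<^sub>R sgn a"] by simp
  qed
  \<comment> \<open>\<eta> < 1 gives \<eta>^2 \<le> \<eta>, hence |h| \<le> \<eta> \<open>K\<close>;
    the other threshold then gives |h| \<le> |a| / 2. Using \<open>K + 1\<close> keeps its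
    denominator positive.\<close>
  have bound: "norm (sgn (a - \<eta> *\<^sub>R b + \<eta>\<^sup>2 *\<^sub>R c) - (sgn a - (\<eta> / norm a) *\<^sub>R P b)) \<le> L * \<eta>\<^sup>2"
    if \<eta>: "0 < \<eta>" "\<eta> < min 1 (norm a / (2 * (K + 1)))" for \<eta>
  proof -
    define h where "h = \<eta>\<^sup>2 *\<^sub>R c - \<eta> *\<^sub>R b"
    have "\<eta>\<^sup>2 \<le> \<eta>" using \<eta> by (simp add: power2_eq_square)
    then have "\<eta>\<^sup>2 * norm c \<le> \<eta> * norm c" by (intro mult_right_mono) auto
    then have hK: "norm h \<le> \<eta> * K"
      using norm_triangle_ineq4[of "\<eta>\<^sup>2 *\<^sub>R c" "\<eta> *\<^sub>R b"] \<eta> by (simp add: h_def K_def algebra_simps)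
    have "\<eta> * (2 * (K + 1)) \<le> norm a"
      using \<eta> K by (simp add: pos_less_divide_eq)
    then have h2: "norm h \<le> norm a / 2" using hK \<eta>(1) by (simp add: algebra_simps)
    have "sgn (a - \<eta> *\<^sub>R b + \<eta>\<^sup>2 *\<^sub>R c) - (sgn a - (\<eta> / norm a) *\<^sub>R P b)
        = (sgn (a + h) - sgn a - (1 / norm a) *\<^sub>R P h) + (\<eta>\<^sup>2 / norm a) *\<^sub>R P c"
    proof -
      have "P h = \<eta>\<^sup>2 *\<^sub>R P c - \<eta> *\<^sub>R P b"
        unfolding h_def diff_conv_add_uminus by (metis P_lin scaleR_minus_left)
      then have "(1 / norm a) *\<^sub>R P h = (\<eta>\<^sup>2 / norm a) *\<^sub>R P c - (\<eta> / norm a) *\<^sub>R P b"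
        by (simp add: scaleR_diff_right)
      moreover have "a - \<eta> *\<^sub>R b + \<eta>\<^sup>2 *\<^sub>R c = a + h" by (simp add: h_def)
      ultimately show ?thesis by (simp only:) simp
    qed
    also have "norm \<dots> \<le> 5 * (norm h)\<^sup>2 / (norm a)\<^sup>2 + \<eta>\<^sup>2 / norm a * norm (P c)"
      using norm_triangle_ineq[of "sgn (a + h) - sgn a - (1 / norm a) *\<^sub>R P h" "(\<eta>\<^sup>2 / norm a) *\<^sub>R P c"]
        sgn_first_order_expansion[OF assms h2]
      by (simp add: P_def)
    also have "\<dots> \<le> 5 * (\<eta> * K)\<^sup>2 / (norm a)\<^sup>2 + \<eta>\<^sup>2 / norm a * (2 * norm c)"
      using hK P_bound[of c] by (intro add_mono divide_right_mono mult_left_mono power_mono) auto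
    finally show ?thesis by (simp add: L_def algebra_simps power_mult_distrib)
  qed
  have "0 < min 1 (norm a / (2 * (K + 1)))" using K assms by simp
  from eventually_at_right_real[OF this]
  have "\<forall>\<^sub>F \<eta> in at_right 0.
          norm (norm (sgn (a - \<eta> *\<^sub>R b + \<eta>\<^sup>2 *\<^sub>R c) - (sgn a - (\<eta> / norm a) *\<^sub>R P b))) \<le> L * norm (\<eta>\<^sup>2)"
    by eventually_elim (use bound in simp)
  then show ?thesis unfolding P_def by (rule bigoI)
qed

section \<open>Gradients and batch means\<close>

lemma GDERIV_unique:
  assumes "GDERIV F x :> D" "GDERIV F x :> E"
  shows "D = E"
proof -
  have "(\<lambda>h. inner h D) = (\<lambda>h. inner h E)"
    using assms unfolding gderiv_def by (rule has_derivative_unique)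
  then show ?thesis by (metis vector_eq_rdot inner_commute)
qed

text \<open>Riesz representation in finite dimension: a linear functional is the inner product with
  the vector of its values on the basis. Together with uniqueness this makes the definite
  description in \<open>gradient\<close> meaningful.\<close>

lemma has_gradient:
  fixes F :: "'v::euclidean_space \<Rightarrow> real"
  assumes "F differentiable (at x)"
  shows "GDERIV F x :> gradient F x"
proof -
  obtain F' where F': "(F has_derivative F') (at x)"
    using assms by (auto simp: differentiable_def)
  interpret bounded_linear F' using F' by (rule has_derivative_bounded_linear)
  have "F' h = inner h (\<Sum>b\<in>Basis. F' b *\<^sub>R b)" for h
  proof -
    have "F' h = F' (\<Sum>b\<in>Basis. inner h b *\<^sub>R b)" by (simp add: euclidean_representation)
    also have "\<dots> = inner h (\<Sum>b\<in>Basis. F' b *\<^sub>R b)"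
      by (simp add: sum scaleR inner_sum_right mult.commute)
    finally show ?thesis .
  qed
  then have "F' = (\<lambda>h. inner h (\<Sum>b\<in>Basis. F' b *\<^sub>R b))" by blast
  then have "GDERIV F x :> (\<Sum>b\<in>Basis. F' b *\<^sub>R b)"
    using F' by (metis gderiv_def)
  then show ?thesis
    unfolding gradient_def by (metis theI' GDERIV_unique)
qed

text \<open>Links the mean of per-sample gradients, which the update uses, to the gradient of the
  mean loss, to which the chain rule applies.\<close>

lemma GDERIV_batch_mean:
  fixes F :: "'v::euclidean_space \<Rightarrow> 'x \<Rightarrow> 'y \<Rightarrow> real"
  assumes "\<And>x y. (x, y) \<in> B \<Longrightarrow> (\<lambda>v. F v x y) differentiable (at a)"
  shows "GDERIV (\<lambda>v. batch_mean B (F v)) a :> batch_mean B (\<lambda>x y. gradient (\<lambda>v. F v x y) a)"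
proof -
  have "((\<lambda>v. F v x y) has_derivative (\<lambda>h. inner h (gradient (\<lambda>v. F v x y) a))) (at a)"
    if "(x, y) \<in> B" for x y
    using has_gradient[OF assms[OF that]] by (simp add: gderiv_def)
  then have "((\<lambda>v. 1 / real (card B) * (\<Sum>z\<in>B. F v (fst z) (snd z))) has_derivative
        (\<lambda>h. 1 / real (card B) * (\<Sum>z\<in>B. inner h (gradient (\<lambda>v. F v (fst z) (snd z)) a)))) (at a)"
    by (intro derivative_intros) auto
  then show ?thesis
    by (simp add: gderiv_def batch_mean_def case_prod_beta inner_sum_right)
qed

section \<open>Frobenius inner product and vectorization\<close>

text \<open>Gives the adjoint of right multiplication by \<open>B\<close>, from which gradients with
  respect to a factor are read off.\<close>

lemma inner_matrix_mult_left:
  fixes A :: "real^'n^'m" and H :: "real^'k^'m" and B :: "real^'n^'k"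
  shows "inner (H ** B) A = inner H (A ** transpose B)"
proof -
  have "inner (H ** B) A = (\<Sum>i\<in>UNIV. \<Sum>j\<in>UNIV. \<Sum>k\<in>UNIV. H $ i $ k * (B $ k $ j * A $ i $ j))"
    by (simp add: inner_vec_def matrix_matrix_mult_def sum_distrib_right mult.assoc)
  also have "\<dots> = (\<Sum>i\<in>UNIV. \<Sum>k\<in>UNIV. \<Sum>j\<in>UNIV. H $ i $ k * (B $ k $ j * A $ i $ j))"
    by (intro sum.cong refl sum.swap)
  also have "\<dots> = inner H (A ** transpose B)"
    by (simp add: inner_vec_def matrix_matrix_mult_def transpose_def sum_distrib_left mult_ac)
  finally show ?thesis .
qed

lemma inner_transpose:
  fixes A B :: "real^'n^'m"
  shows "inner (transpose A) (transpose B) = inner A B"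
  unfolding inner_vec_def transpose_def by (simp, rule sum.swap)

lemma linear_transpose: "linear (transpose :: real^'n^'m \<Rightarrow> real^'m^'n)"
  by (intro linearI) (simp_all add: transpose_def vec_eq_iff)

lemma linear_matrix_mult_left: "linear (\<lambda>P :: real^'k^'m. P ** (B :: real^'n^'k))"
  by (intro linearI) (simp_all add: matrix_matrix_mult_def vec_eq_iff algebra_simps sum.distrib sum_distrib_left)

lemma linear_matrix_mult_right: "linear (\<lambda>P :: real^'n^'k. (A :: real^'k^'m) ** P)"
  by (intro linearI) (simp_all add: matrix_matrix_mult_def vec_eq_iff algebra_simps sum.distrib sum_distrib_left)

lemma linear_vectorize: "linear vectorize"
  by (intro linearI) (simp_all add: vectorize_def vec_eq_iff)

lemma inner_vectorize: "inner (vectorize A) (vectorize B) = inner A B"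
  by (simp add: vectorize_def inner_vec_def sum.cartesian_product case_prod_beta UNIV_Times_UNIV)

lemma norm_vectorize: "norm (vectorize A) = norm A"
  by (simp add: norm_eq_sqrt_inner inner_vectorize)

lemma direction_eq_sgn: "direction W = sgn W"
  by (simp add: direction_def sgn_div_norm inverse_eq_divide)

lemma mat_1_minus_outer_mult: "(mat 1 - outer w w) *v z = z - inner w z *\<^sub>R w"
proof -
  have "outer w w *v z = inner w z *\<^sub>R w"
    by (simp add: outer_def matrix_vector_mult_def vec_eq_iff inner_vec_def sum_distrib_left mult_ac)
  then show ?thesis by (simp add: matrix_vector_mult_diff_rdistrib)
qed

section \<open>Gradients under linear maps and rescaling\<close>

text \<open>By the chain rule, the gradient is pulled back through the adjoint of \<open>T\<close>;
  the assumption \<open>adj\<close> says that \<open>E\<close> is the image of \<open>D\<close>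
  under it.\<close>

lemma GDERIV_comp_linear:
  fixes T :: "'v::euclidean_space \<Rightarrow> 'w::real_inner"
  assumes "linear T" and adj: "\<And>h. inner (T h) D = inner h E" and "GDERIV F (T x) :> D"
  shows "GDERIV (\<lambda>P. F (T P)) x :> E"
proof -
  have "((\<lambda>P. F (T P)) has_derivative (\<lambda>h. inner (T h) D)) (at x)"
    using has_derivative_compose[OF linear_imp_has_derivative[OF assms(1)]
        assms(3)[unfolded gderiv_def]] .
  then show ?thesis by (simp add: gderiv_def adj)
qed

text \<open>By invariance, \<open>F\<close> equals its composition with scaling by 1 / \<rho>, which
  carries \<rho> W back to W; the chain rule produces the factor.\<close>

lemma GDERIV_scale_invariant:
  assumes inv: "\<And>W \<rho>. \<rho> > 0 \<Longrightarrow> F (\<rho> *\<^sub>R W) = F W" and \<rho>: "\<rho> > 0"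
    and F: "GDERIV F W :> D"
  shows "GDERIV F (\<rho> *\<^sub>R W) :> (1 / \<rho>) *\<^sub>R D"
proof -
  have "((\<lambda>X. F ((1 / \<rho>) *\<^sub>R X)) has_derivative (\<lambda>h. inner ((1 / \<rho>) *\<^sub>R h) D)) (at (\<rho> *\<^sub>R W))"
    by (rule has_derivative_compose[where g = F and f = "\<lambda>X. (1 / \<rho>) *\<^sub>R X"])
       (use F \<rho> in \<open>auto simp: gderiv_def intro!: derivative_eq_intros\<close>)
  moreover have "F ((1 / \<rho>) *\<^sub>R X) = F X" for X using inv[of "1 / \<rho>" X] \<rho> by simp
  ultimately show ?thesis by (simp add: gderiv_def)
qed

section \<open>Direction after one gradient step on both factors\<close>

theorem claim3p1:
  fixes g :: "real^'n^'m \<Rightarrow> 'a \<Rightarrow> 'b"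
    and f :: "real^'n^'m \<Rightarrow> 'p \<Rightarrow> 'x \<Rightarrow> 'y"
    and \<l> :: "'y \<Rightarrow> 'y \<Rightarrow> real"
    and B :: "('x \<times> 'y) set"
    and t :: nat
    and \<omega>\<^sub>t :: 'p
    and U\<^sub>t :: "real^'r^'m" and V\<^sub>t :: "real^'r^'n"
    and W\<^sub>t G\<^sub>W G :: "real^'n^'m"
    and G\<^sub>U :: "real^'r^'m" and G\<^sub>V :: "real^'r^'n"
    and w\<^sub>t :: "real^('m \<times> 'n)"
    \<comment> \<open>\<open>U \<eta> s\<close>, \<open>V \<eta> s\<close>: factors at step \<open>s\<close> of the run with learning rate \<open>\<eta>\<close>\<close>
    and U :: "real \<Rightarrow> nat \<Rightarrow> real^'r^'m" and V :: "real \<Rightarrow> nat \<Rightarrow> real^'r^'n"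
  defines "W\<^sub>t \<equiv> U\<^sub>t ** transpose V\<^sub>t"
    and "G\<^sub>U \<equiv> batch_mean B (\<lambda>x y. gradient (\<lambda>P. \<l> (f (P ** transpose V\<^sub>t) \<omega>\<^sub>t x) y) U\<^sub>t)"
    and "G\<^sub>V \<equiv> batch_mean B (\<lambda>x y. gradient (\<lambda>P. \<l> (f (U\<^sub>t ** transpose P) \<omega>\<^sub>t x) y) V\<^sub>t)"
    and "G\<^sub>W \<equiv> gradient (\<lambda>W. batch_mean B (\<lambda>x y. \<l> (f W \<omega>\<^sub>t x) y)) (direction W\<^sub>t)"
    and "G \<equiv> G\<^sub>W ** V\<^sub>t ** transpose V\<^sub>t + U\<^sub>t ** transpose U\<^sub>t ** G\<^sub>W"
    and "w\<^sub>t \<equiv> vectorize (direction W\<^sub>t)"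
  assumes layer: "is_layer_of g f"
    and normalized: "normalized_layer g"
    and batch: "finite B" "B \<noteq> {}"
    and nonzero: "W\<^sub>t \<noteq> 0"
    and diff_U: "\<And>x y. (x, y) \<in> B \<Longrightarrow>
          (\<lambda>P. \<l> (f (P ** transpose V\<^sub>t) \<omega>\<^sub>t x) y) differentiable (at U\<^sub>t)"
    and diff_V: "\<And>x y. (x, y) \<in> B \<Longrightarrow>
          (\<lambda>P. \<l> (f (U\<^sub>t ** transpose P) \<omega>\<^sub>t x) y) differentiable (at V\<^sub>t)"
    and diff_W: "(\<lambda>W. batch_mean B (\<lambda>x y. \<l> (f W \<omega>\<^sub>t x) y)) differentiable (at (direction W\<^sub>t))"
    and state: "\<And>\<eta>. \<eta> > 0 \<Longrightarrow> U \<eta> t = U\<^sub>t" "\<And>\<eta>. \<eta> > 0 \<Longrightarrow> V \<eta> t = V\<^sub>t"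
    and sgd: "\<And>\<eta>. \<eta> > 0 \<Longrightarrow> U \<eta> (Suc t) = U \<eta> t - \<eta> *\<^sub>R G\<^sub>U"
             "\<And>\<eta>. \<eta> > 0 \<Longrightarrow> V \<eta> (Suc t) = V \<eta> t - \<eta> *\<^sub>R G\<^sub>V"
  shows "(\<lambda>\<eta>. norm (vectorize (direction (U \<eta> (Suc t) ** transpose (V \<eta> (Suc t))))
              - (w\<^sub>t - (\<eta> / (norm W\<^sub>t)\<^sup>2) *\<^sub>R ((mat 1 - outer w\<^sub>t w\<^sub>t) *v vectorize G))))
         \<in> O[at_right 0](\<lambda>\<eta>. \<eta>\<^sup>2)"
proof -
  define L where "L W = batch_mean B (\<lambda>x y. \<l> (f W \<omega>\<^sub>t x) y)" for W
  define q where "q = norm W\<^sub>t"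
  have q: "q > 0" using nonzero by (simp add: q_def)
  have W\<^sub>t: "W\<^sub>t = q *\<^sub>R direction W\<^sub>t"
    using q by (simp add: direction_def q_def)
  have inv: "L (\<rho> *\<^sub>R W) = L W" if "\<rho> > 0" for W and \<rho> :: real
  proof -
    obtain pre :: "'p \<Rightarrow> 'x \<Rightarrow> 'a" and post :: "'p \<Rightarrow> 'b \<Rightarrow> 'y"
      where f: "\<And>W \<omega> x. f W \<omega> x = post \<omega> (g W (pre \<omega> x))"
      using layer unfolding is_layer_of_def by blast
    have "g (\<rho> *\<^sub>R W) z = g W z" for z
      using normalized that unfolding normalized_layer_def by metis
    then show ?thesis by (simp add: L_def f)
  qed
  have "GDERIV L (direction W\<^sub>t) :> G\<^sub>W"
    using has_gradient[OF diff_W] by (simp add: L_def[abs_def] G\<^sub>W_def)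
  then have "GDERIV L (q *\<^sub>R direction W\<^sub>t) :> (1 / q) *\<^sub>R G\<^sub>W"
    by (intro GDERIV_scale_invariant inv q)
  then have gW: "GDERIV L (U\<^sub>t ** transpose V\<^sub>t) :> (1 / q) *\<^sub>R G\<^sub>W"
    using W\<^sub>t by (simp add: W\<^sub>t_def)

  \<comment> \<open>The same gradient is found twice, as the batch mean in the update and by pulling
    back the gradient at \<open>W\<^sub>t\<close>; uniqueness equates the two. The argument for
    \<open>G\<^sub>V\<close> is the same.\<close>
  have "GDERIV (\<lambda>P. L (P ** transpose V\<^sub>t)) U\<^sub>t :> G\<^sub>U"
    unfolding L_def G\<^sub>U_def by (rule GDERIV_batch_mean[OF diff_U])
  moreover have "GDERIV (\<lambda>P. L (P ** transpose V\<^sub>t)) U\<^sub>t :> (1 / q) *\<^sub>R (G\<^sub>W ** V\<^sub>t)"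
    by (rule GDERIV_comp_linear[OF linear_matrix_mult_left _ gW])
       (simp add: inner_matrix_mult_left transpose_transpose)
  ultimately have G\<^sub>U: "G\<^sub>U = (1 / q) *\<^sub>R (G\<^sub>W ** V\<^sub>t)"
    by (rule GDERIV_unique)

  have "GDERIV (\<lambda>P. L (U\<^sub>t ** transpose P)) V\<^sub>t :> G\<^sub>V"
    unfolding L_def G\<^sub>V_def by (rule GDERIV_batch_mean[OF diff_V])
  moreover have "GDERIV (\<lambda>P. L (U\<^sub>t ** transpose P)) V\<^sub>t :> (1 / q) *\<^sub>R (transpose G\<^sub>W ** U\<^sub>t)"
  proof (rule GDERIV_comp_linear[where T = "\<lambda>P. U\<^sub>t ** transpose P", OF _ _ gW])
    show "linear (\<lambda>P. U\<^sub>t ** transpose P)"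
      using linear_compose[OF linear_transpose linear_matrix_mult_right] by (simp add: o_def)
    show "inner (U\<^sub>t ** transpose h) ((1 / q) *\<^sub>R G\<^sub>W) = inner h ((1 / q) *\<^sub>R (transpose G\<^sub>W ** U\<^sub>t))" for h
    proof -
      \<comment> \<open>Transposition preserves the inner product and turns left multiplication into
        right multiplication, whose adjoint is known.\<close>
      have "inner (U\<^sub>t ** transpose h) G\<^sub>W = inner (h ** transpose U\<^sub>t) (transpose G\<^sub>W)"
        by (metis inner_transpose matrix_transpose_mul transpose_transpose)
      also have "\<dots> = inner h (transpose G\<^sub>W ** U\<^sub>t)"
        by (simp add: inner_matrix_mult_left transpose_transpose)
      finally show ?thesis by simp
    qed
  qed
  ultimately have "G\<^sub>V = (1 / q) *\<^sub>R (transpose G\<^sub>W ** U\<^sub>t)"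
    by (rule GDERIV_unique)
  then have G\<^sub>V: "transpose G\<^sub>V = (1 / q) *\<^sub>R (transpose U\<^sub>t ** G\<^sub>W)"
    by (simp add: transpose_scalar matrix_transpose_mul transpose_transpose)

  \<comment> \<open>The cross term of the two updates; it does not depend on \<eta>, so the product
    after the step is an exact quadratic polynomial in \<eta>.\<close>
  define C where "C = G\<^sub>U ** transpose G\<^sub>V"
  have step: "U \<eta> (Suc t) ** transpose (V \<eta> (Suc t)) = W\<^sub>t - \<eta> *\<^sub>R ((1 / q) *\<^sub>R G) + \<eta>\<^sup>2 *\<^sub>R C"
    if "\<eta> > 0" for \<eta>
  proof -
    have "U \<eta> (Suc t) ** transpose (V \<eta> (Suc t))
        = (U\<^sub>t - \<eta> *\<^sub>R G\<^sub>U) ** (transpose V\<^sub>t - \<eta> *\<^sub>R transpose G\<^sub>V)"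
      by (simp add: sgd state that linear_diff[OF linear_transpose] transpose_scalar)
    also have "\<dots> = W\<^sub>t - \<eta> *\<^sub>R (G\<^sub>U ** transpose V\<^sub>t + U\<^sub>t ** transpose G\<^sub>V) + \<eta>\<^sup>2 *\<^sub>R C"
      by (simp add: C_def W\<^sub>t_def linear_diff[OF linear_matrix_mult_left]
          linear_diff[OF linear_matrix_mult_right] linear_scale[OF linear_matrix_mult_left]
          linear_scale[OF linear_matrix_mult_right] power2_eq_square algebra_simps)
    also have "G\<^sub>U ** transpose V\<^sub>t + U\<^sub>t ** transpose G\<^sub>V = (1 / q) *\<^sub>R G"
      by (simp add: G_def G\<^sub>U G\<^sub>V linear_scale[OF linear_matrix_mult_left]
          linear_scale[OF linear_matrix_mult_right] matrix_mul_assoc scaleR_add_right)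
    finally show ?thesis .
  qed
  \<comment> \<open>\<open>vectorize\<close> is a linear isometry, so the claim is moved back to
    matrices. One factor 1 / \<open>q\<close> comes from the gradient at \<open>W\<^sub>t\<close>
    and one from the derivative of \<open>sgn\<close>.\<close>
  have "norm (vectorize (direction (U \<eta> (Suc t) ** transpose (V \<eta> (Suc t))))
            - (w\<^sub>t - (\<eta> / (norm W\<^sub>t)\<^sup>2) *\<^sub>R ((mat 1 - outer w\<^sub>t w\<^sub>t) *v vectorize G)))
      = norm (sgn (W\<^sub>t - \<eta> *\<^sub>R ((1 / q) *\<^sub>R G) + \<eta>\<^sup>2 *\<^sub>R C) - (sgn W\<^sub>t
          - (\<eta> / norm W\<^sub>t) *\<^sub>R ((1 / q) *\<^sub>R G - inner (sgn W\<^sub>t) ((1 / q) *\<^sub>R G) *\<^sub>R sgn W\<^sub>t)))"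
    (is "?lhs \<eta> = ?rhs \<eta>") if "\<eta> > 0" for \<eta>
  proof -
    have "?lhs \<eta> = norm (vectorize (sgn (W\<^sub>t - \<eta> *\<^sub>R ((1 / q) *\<^sub>R G) + \<eta>\<^sup>2 *\<^sub>R C)
        - (sgn W\<^sub>t - (\<eta> / q\<^sup>2) *\<^sub>R (G - inner (sgn W\<^sub>t) G *\<^sub>R sgn W\<^sub>t))))"
      by (simp only: step[OF that] mat_1_minus_outer_mult w\<^sub>t_def inner_vectorize direction_eq_sgn
          linear_diff[OF linear_vectorize] linear_scale[OF linear_vectorize] q_def)
    also have "(\<eta> / q\<^sup>2) *\<^sub>R (G - inner (sgn W\<^sub>t) G *\<^sub>R sgn W\<^sub>t)
        = (\<eta> / norm W\<^sub>t) *\<^sub>R ((1 / q) *\<^sub>R G - inner (sgn W\<^sub>t) ((1 / q) *\<^sub>R G) *\<^sub>R sgn W\<^sub>t)"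
      by (simp add: q_def power2_eq_square scaleR_diff_right)
    finally show ?thesis by (simp only: norm_vectorize)
  qed
  \<comment> \<open>The run is specified only for positive \<eta>, and the one-sided filter sees no
    others.\<close>
  then have "\<forall>\<^sub>F \<eta> in at_right 0. ?lhs \<eta> = ?rhs \<eta>"
    by (rule eventually_mono[OF eventually_at_right_less])
  moreover have "?rhs \<in> O[at_right 0](\<lambda>\<eta>. \<eta>\<^sup>2)"
    using nonzero by (rule sgn_quadratic_perturbation)
  ultimately show ?thesis
    by (simp only: landau_o.big.in_cong)
qed

end
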